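(* Consider Witsenhausen's counterexample with cost parameter $\lambda>0$, and its finite observation models with costs $J_{l,n}$. For any $\varepsilon>0$ there exist a pair $(l,n)$ (with $l>0$ real and $n\ge1$ an integer) and $m>0$ such that, with $M:=[-m,m]$, any optimal policy $(\pi^{1*},\pi^{2*})$ in the set $\Pi_{l,n}^{1,M}\times\Pi_{l,n}^{2,M}$ for the cost $J_{l,n}$ is $\varepsilon$-optimal for Witsenhausen's counterexample when extended to $\mathbb R\times\mathbb R$ via $\gamma^i=\pi^{i*}\circ q_{l,n}$, $i=1,2$; i.e. $J(\pi^{1*}\circ q_{l,n},\pi^{2*}\circ q_{l,n})\le J^*+\varepsilon$. Here $\Pi_{l,n}^{i,M}$ is the set of maps $\pi^i:\mathsf Z_{l,n}\to\mathbb R$ with $\pi^i(\mathsf Z_{l,n})\subset M$.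
   Context: Witsenhausen's counterexample: $y^1$ and $v$ are independent standard Gaussian random variables; Agent 1 observes $y^1$ and plays $u^1=\gamma^1(y^1)$; Agent 2 observes $y^2=u^1+v$ and plays $u^2=\gamma^2(y^2)$, with $\gamma^1,\gamma^2:\mathbb R\to\mathbb R$ Borel measurable. $J(\gamma^1,\gamma^2)=E[\lambda(u^1-y^1)^2+(u^2-u^1)^2]$ and $J^*=\inf_{\gamma^1,\gamma^2}J(\gamma^1,\gamma^2)$. Let $f(u,y)=\exp\{-(u^2-2yu)/2\}$ and $\tilde c(y^1,y^2,u^1,u^2)=(\lambda(u^1-y^1)^2+(u^2-u^1)^2)f(u^1,y^2)$, so that $J(\gamma^1,\gamma^2)=\int\tilde c(y^1,y^2,\gamma^1(y^1),\gamma^2(y^2))\,\mathbb P_{\mathsf g}(dy^1)\mathbb P_{\mathsf g}(dy^2)$ with $\mathbb P_{\mathsf g}$ the standard Gaussian law. Finite models: for real $l>0$ and integer $n\ge1$, $q_{l,n}$ is the uniform quantizer on $[-l,l]$ with $n$ output levels: with $\tau=2l/n$, the levels $y_1<\dots<y_n$ are the midpoints of the $n$ consecutive intervals of length $\tau$ partitioning $[-l,l]$, and $q_{l,n}(y)=y_j$ for $y\in[y_j-\tau/2,y_j+\tau/2)$ (the endpoint $l$ is mapped to $y_n$). It is extended to $\mathbb R$ by $q_{l,n}(y)=y_0:=0$ for $y\notin[-l,l]$. $\mathsf Z_{l,n}=\{y_0,y_1,\dots,y_n\}$, $\mathbb P_{l,n}=\mathbb P_{\mathsf g}\circ q_{l,n}^{-1}$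 on $\mathsf Z_{l,n}$, and for $\pi^1,\pi^2:\mathsf Z_{l,n}\to\mathbb R$, $J_{l,n}(\pi^1,\pi^2)=\sum_{z,z'\in\mathsf Z_{l,n}}\tilde c(z,z',\pi^1(z),\pi^2(z'))\,\mathbb P_{l,n}(z)\mathbb P_{l,n}(z')$. *)

theory Defs
  imports "HOL-Probability.Probability"
begin

text \<open>
  The primitive randomness \<open>(y\<^sup>1, v)\<close> is realised canonically on the product of two standard
  Gaussian laws.  The cost takes values in \<^typ>\<open>ennreal\<close> because it is infinite for some
  measurable policies; for \<open>lam > 0\<close> the integrand is nonnegative, so nothing is truncated.
\<close>

definition W_cost :: "real \<Rightarrow> (real \<Rightarrow> real) \<Rightarrow> (real \<Rightarrow> real) \<Rightarrow> ennreal" where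
  "W_cost lam g1 g2 =
    (\<integral>\<^sup>+ (y1, v). ennreal (let u1 = g1 y1; y2 = u1 + v; u2 = g2 y2
                         in lam * (u1 - y1)\<^sup>2 + (u2 - u1)\<^sup>2)
       \<partial>(std_normal_distribution \<Otimes>\<^sub>M std_normal_distribution))"

definition W_opt :: "real \<Rightarrow> ennreal" where
  "W_opt lam = (INF (g1, g2) \<in> borel_measurable borel \<times> borel_measurable borel. W_cost lam g1 g2)"

text \<open>
  \<open>c_red\<close> is the cost after the change of measure that makes \<open>y\<^sup>1\<close> and \<open>y\<^sup>2\<close> independent
  standard Gaussian: \<open>f u y\<close> is the density of \<open>N(u,1)\<close> relative to \<open>N(0,1)\<close> at \<open>y\<close>.
\<close>

definition f_dens :: "real \<Rightarrow> real \<Rightarrow> real" where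
  "f_dens u y = exp (- (u\<^sup>2 - 2 * y * u) / 2)"

definition c_red :: "real \<Rightarrow> real \<Rightarrow> real \<Rightarrow> real \<Rightarrow> real \<Rightarrow> real" where
  "c_red lam y1 y2 u1 u2 = (lam * (u1 - y1)\<^sup>2 + (u2 - u1)\<^sup>2) * f_dens u1 y2"

definition q_step :: "real \<Rightarrow> nat \<Rightarrow> real" where
  "q_step l n = 2 * l / real n"

definition q_level :: "real \<Rightarrow> nat \<Rightarrow> nat \<Rightarrow> real" where
  "q_level l n j = - l + (real j - 1 / 2) * q_step l n"

definition q_cell :: "real \<Rightarrow> nat \<Rightarrow> nat \<Rightarrow> real set" where
  "q_cell l n j = {q_level l n j - q_step l n / 2 ..< q_level l n j + q_step l n / 2}"

text \<open>For \<open>l > 0\<close> and \<open>n \<ge> 1\<close> the cells with \<open>1 \<le> j \<le> n\<close> partition \<open>{-l..<l}\<close>.\<close>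

definition quantizer :: "real \<Rightarrow> nat \<Rightarrow> real \<Rightarrow> real" where
  "quantizer l n y =
    (if y \<notin> {-l..l} then 0
     else if y = l then q_level l n n
     else q_level l n (THE j. j \<in> {1..n} \<and> y \<in> q_cell l n j))"

text \<open>
  For odd \<open>n\<close> the extra level \<open>0\<close> coincides with the middle level; since \<open>Z_fin\<close> is a set,
  its mass then collects both the middle cell and the complement of \<open>{-l..l}\<close>.
\<close>

definition Z_fin :: "real \<Rightarrow> nat \<Rightarrow> real set" where
  "Z_fin l n = insert 0 (q_level l n ` {1..n})"

definition P_fin :: "real \<Rightarrow> nat \<Rightarrow> real \<Rightarrow> real" where
  "P_fin l n z = measure std_normal_distribution (quantizer l n -` {z})"

definition J_fin :: "real \<Rightarrow> real \<Rightarrow> nat \<Rightarrow> (real \<Rightarrow> real) \<Rightarrow> (real \<Rightarrow> real) \<Rightarrow> real" where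
  "J_fin lam l n p1 p2 =
    (\<Sum>z\<in>Z_fin l n. \<Sum>z'\<in>Z_fin l n. c_red lam z z' (p1 z) (p2 z') * P_fin l n z * P_fin l n z')"

definition Pol_fin :: "real \<Rightarrow> nat \<Rightarrow> real \<Rightarrow> (real \<Rightarrow> real) set" where
  "Pol_fin l n m = Z_fin l n \<rightarrow>\<^sub>E {-m..m}"

definition optimal_fin ::
    "real \<Rightarrow> real \<Rightarrow> nat \<Rightarrow> real \<Rightarrow> (real \<Rightarrow> real) \<Rightarrow> (real \<Rightarrow> real) \<Rightarrow> bool" where
  "optimal_fin lam l n m p1 p2 \<longleftrightarrow>
    p1 \<in> Pol_fin l n m \<and> p2 \<in> Pol_fin l n m \<and>
    (\<forall>s1\<in>Pol_fin l n m. \<forall>s2\<in>Pol_fin l n m. J_fin lam l n p1 p2 \<le> J_fin lam l n s1 s2)"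

end

theory Submission
  imports Defs
begin

text \<open>
  Policies of finite cost may be truncated, second agent first: the first control is square
  integrable because \<open>lam > 0\<close>, which gives domination, and once the second policy is bounded
  truncating the first one is dominated as well.  Bounded measurable policies are then almost
  everywhere limits of continuous ones with the same bound \<open>m\<close>; passing to \<open>c_red\<close> decouples the
  observations, so the limits can be taken separately in each policy.  Hence it suffices to
  compare with continuous policies bounded by \<open>m\<close>, and for those the quantized cost converges to
  the true one.  Finally, for controls in \<open>[-m, m]\<close> the function \<open>c_red\<close> changes under quantization
  of the observations by at most \<open>quant_err\<close>, which does not depend on the controls and whose
  Gaussian integral tends to 0; so the true cost exceeds the finite-model cost by an amount that
  is small uniformly in the policies.
\<close>

subsection \<open>Change of measure\<close>

abbreviation gauss2 :: "(real \<times> real) measure" where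
  "gauss2 \<equiv> std_normal_distribution \<Otimes>\<^sub>M std_normal_distribution"

interpretation gauss: prob_space std_normal_distribution
  by (rule prob_space_normal_density) simp

lemma f_dens_pos: "f_dens u z > 0"
  by (simp add: f_dens_def)

lemma c_red_nonneg: "lam > 0 \<Longrightarrow> c_red lam y z u w \<ge> 0"
  by (simp add: c_red_def f_dens_def)

lemma borel_measurable_f_dens [measurable (raw)]:
  assumes [measurable]: "g \<in> borel_measurable M" "h \<in> borel_measurable M"
  shows "(\<lambda>x. f_dens (g x) (h x)) \<in> borel_measurable M"
  unfolding f_dens_def by measurable

lemma borel_measurable_c_red [measurable (raw)]:
  assumes [measurable]: "a \<in> borel_measurable M" "b \<in> borel_measurable M"
    "g \<in> borel_measurable M" "h \<in> borel_measurable M"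
  shows "(\<lambda>x. c_red lam (a x) (b x) (g x) (h x)) \<in> borel_measurable M"
  unfolding c_red_def by measurable

lemma std_normal_density_shift:
  "std_normal_density (z - u) = std_normal_density z * f_dens u z"
proof -
  have "- (z - u)\<^sup>2 / 2 = - z\<^sup>2 / 2 + - (u\<^sup>2 - 2 * z * u) / 2"
    by (simp add: power2_eq_square field_simps)
  then show ?thesis
    by (simp add: std_normal_density_def f_dens_def exp_add [symmetric])
qed

text \<open>Translation of Lebesgue measure moves the shift from \<open>F\<close> to the density,
  and completing the square splits the shifted density into the standard one times
  \<open>f_dens u\<close>. So \<open>f_dens u\<close> is the Radon-Nikodym derivative of N(u,1) with
  respect to N(0,1).\<close>

lemma nn_integral_gauss_shift:
  assumes [measurable]: "F \<in> borel_measurable borel"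
  shows "(\<integral>\<^sup>+v. F (u + v) \<partial>std_normal_distribution)
    = (\<integral>\<^sup>+z. ennreal (f_dens u z) * F z \<partial>std_normal_distribution)"
proof -
  have "(\<integral>\<^sup>+v. F (u + v) \<partial>std_normal_distribution)
      = (\<integral>\<^sup>+v. ennreal (std_normal_density v) * F (u + v) \<partial>lborel)"
    by (subst nn_integral_density) auto
  also have "\<dots> = (\<integral>\<^sup>+z. ennreal (std_normal_density (z - u)) * F z \<partial>lborel)"
    by (subst (2) nn_integral_real_affine [where t = u and c = 1]) auto
  also have "\<dots> = (\<integral>\<^sup>+z. ennreal (std_normal_density z) * (ennreal (f_dens u z) * F z) \<partial>lborel)"
    using f_dens_pos [THEN less_imp_le]
    by (intro nn_integral_cong) (auto simp: std_normal_density_shift ennreal_mult mult.assoc)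
  also have "\<dots> = (\<integral>\<^sup>+z. ennreal (f_dens u z) * F z \<partial>std_normal_distribution)"
    by (subst nn_integral_density) auto
  finally show ?thesis .
qed

text \<open>For fixed \<open>y\<close> the first control \<open>g1 y\<close> is a constant, so the
  inner integral over \<open>v\<close> is a Gaussian integral shifted by \<open>g1 y\<close>.
  Afterwards \<open>g2\<close> is applied to an integration variable that is independent of
  \<open>y\<close> and of \<open>g1\<close>.\<close>

lemma W_cost_c_red:
  assumes [measurable]: "g1 \<in> borel_measurable borel" "g2 \<in> borel_measurable borel"
    and lam: "lam > 0"
  shows "W_cost lam g1 g2 = (\<integral>\<^sup>+(y, z). ennreal (c_red lam y z (g1 y) (g2 z)) \<partial>gauss2)"
proof -
  have "W_cost lam g1 g2 = (\<integral>\<^sup>+y. \<integral>\<^sup>+v. ennreal (lam * (g1 y - y)\<^sup>2 + (g2 (g1 y + v) - g1 y)\<^sup>2)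
      \<partial>std_normal_distribution \<partial>std_normal_distribution)"
    unfolding W_cost_def Let_def by (subst gauss.nn_integral_fst [symmetric]) auto
  also have "\<dots> = (\<integral>\<^sup>+y. \<integral>\<^sup>+z. ennreal (c_red lam y z (g1 y) (g2 z))
      \<partial>std_normal_distribution \<partial>std_normal_distribution)"
  proof (rule nn_integral_cong)
    fix y :: real
    show "(\<integral>\<^sup>+v. ennreal (lam * (g1 y - y)\<^sup>2 + (g2 (g1 y + v) - g1 y)\<^sup>2) \<partial>std_normal_distribution)
      = (\<integral>\<^sup>+z. ennreal (c_red lam y z (g1 y) (g2 z)) \<partial>std_normal_distribution)"
      using lam f_dens_pos [THEN less_imp_le]
      by (subst nn_integral_gauss_shift
          [where F = "\<lambda>z. ennreal (lam * (g1 y - y)\<^sup>2 + (g2 z - g1 y)\<^sup>2)"])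
        (auto intro!: nn_integral_cong simp: c_red_def ennreal_mult [symmetric] mult.commute
            simp del: ennreal_plus)
  qed
  also have "\<dots> = (\<integral>\<^sup>+(y, z). ennreal (c_red lam y z (g1 y) (g2 z)) \<partial>gauss2)"
    by (subst gauss.nn_integral_fst [symmetric]) auto
  finally show ?thesis .
qed

subsection \<open>Dominated convergence for the reduced cost\<close>

text \<open>The integrand is at most the sum of the exponentials of \<open>K * z\<close> and
  \<open>-K * z\<close>. Each of these is a constant multiple of \<open>f_dens K\<close> or
  \<open>f_dens (-K)\<close>, whose Gaussian integral is 1.\<close>

lemma nn_integral_gauss_exp_abs: "(\<integral>\<^sup>+z. ennreal (exp (K * \<bar>z\<bar>)) \<partial>std_normal_distribution) < \<infinity>"
proof -
  have f1: "(\<integral>\<^sup>+z. ennreal (f_dens u z) \<partial>std_normal_distribution) = 1" for u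
    using nn_integral_gauss_shift [of "\<lambda>_. 1" u] gauss.emeasure_space_1 by simp
  have *: "exp (K * z) = exp (K\<^sup>2 / 2) * f_dens K z" for K z :: real
    by (simp add: f_dens_def exp_add [symmetric] field_simps)
  have "(\<integral>\<^sup>+z. ennreal (exp (K * \<bar>z\<bar>)) \<partial>std_normal_distribution)
     \<le> (\<integral>\<^sup>+z. ennreal (exp (K\<^sup>2 / 2)) * ennreal (f_dens K z)
         + ennreal (exp ((-K)\<^sup>2 / 2)) * ennreal (f_dens (-K) z) \<partial>std_normal_distribution)"
    using f_dens_pos [THEN less_imp_le] * [of "-K"]
    by (intro nn_integral_mono)
      (auto simp: ennreal_mult [symmetric] ennreal_plus [symmetric] * [symmetric] abs_if
        simp del: ennreal_plus power2_minus)
  also have "\<dots> < \<infinity>"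
    by (simp add: nn_integral_add nn_integral_cmult f1)
  finally show ?thesis .
qed

lemma nn_integral_gauss_square: "(\<integral>\<^sup>+y. ennreal (1 + y\<^sup>2) \<partial>std_normal_distribution) < \<infinity>"
proof -
  have "integrable std_normal_distribution (\<lambda>y. 1 + y\<^sup>2)"
    using integrable_std_normal_distribution_moment [of 2] by simp
  then have "(\<integral>\<^sup>+y. ennreal (norm (1 + y\<^sup>2)) \<partial>std_normal_distribution) < \<infinity>"
    unfolding integrable_iff_bounded by blast
  moreover have "norm (1 + y\<^sup>2) = 1 + y\<^sup>2" for y :: real
    by simp
  ultimately show ?thesis
    by simp
qed

text \<open>The majorant factorises, so its integral is a product of two finite Gaussian integrals.
  All majorants for the reduced cost have this form; \<open>K = 0\<close> serves the unreduced cost,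
  where no density appears.\<close>

lemma nn_integral_gauss2_dominating:
  assumes "C \<ge> 0"
  shows "(\<integral>\<^sup>+(y, z). ennreal (C * (1 + y\<^sup>2) * exp (K * \<bar>z\<bar>)) \<partial>gauss2) < \<infinity>"
proof -
  let ?E = "\<integral>\<^sup>+z. ennreal (exp (K * \<bar>z\<bar>)) \<partial>std_normal_distribution"
  let ?S = "\<integral>\<^sup>+y. ennreal (1 + y\<^sup>2) \<partial>std_normal_distribution"
  have "(\<integral>\<^sup>+(y, z). ennreal (C * (1 + y\<^sup>2) * exp (K * \<bar>z\<bar>)) \<partial>gauss2)
      = (\<integral>\<^sup>+y. \<integral>\<^sup>+z. ennreal C * ennreal (1 + y\<^sup>2) * ennreal (exp (K * \<bar>z\<bar>))
         \<partial>std_normal_distribution \<partial>std_normal_distribution)"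
    using assms
    by (subst gauss.nn_integral_fst [symmetric]) (auto simp: ennreal_mult simp del: ennreal_plus)
  also have "\<dots> = ennreal C * ?S * ?E"
    by (simp add: nn_integral_cmult nn_integral_multc del: ennreal_plus)
  also have "\<dots> < \<infinity>"
    using nn_integral_gauss_square nn_integral_gauss_exp_abs [of K]
    by (simp add: ennreal_mult_less_top del: ennreal_plus)
  finally show ?thesis .
qed

text \<open>A cylinder over a null set of either factor is null in the product. This allows
  exceptional sets to be treated one observation at a time.\<close>

lemma AE_gauss2:
  assumes "AE y in std_normal_distribution. P y" and "AE z in std_normal_distribution. Q z"
  shows "AE x in gauss2. P (fst x) \<and> Q (snd x)"
proof -
  obtain N1 where N1: "{y \<in> space std_normal_distribution. \<not> P y} \<subseteq> N1"
      "emeasure std_normal_distribution N1 = 0" "N1 \<in> sets std_normal_distribution"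
    using assms(1) by (rule AE_E)
  obtain N2 where N2: "{y \<in> space std_normal_distribution. \<not> Q y} \<subseteq> N2"
      "emeasure std_normal_distribution N2 = 0" "N2 \<in> sets std_normal_distribution"
    using assms(2) by (rule AE_E)
  have "N1 \<times> UNIV \<in> null_sets gauss2" "UNIV \<times> N2 \<in> null_sets gauss2"
    using N1 N2 by (auto intro!: null_setsI simp: gauss.emeasure_pair_measure_Times)
  then have "N1 \<times> UNIV \<union> UNIV \<times> N2 \<in> null_sets gauss2"
    by (rule null_sets.Un)
  then show ?thesis
    by (rule AE_I') (use N1(1) N2(1) in auto)
qed

text \<open>
  With slack 1 in the observations, so that the same majorant serves for quantized ones
  (see \<open>abs_rate_quantizer_le\<close>).
\<close>

definition dom_const :: "real \<Rightarrow> real \<Rightarrow> real" where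
  "dom_const lam m = 2 * lam * ((m + 1)\<^sup>2 + 1) + 4 * m\<^sup>2"

lemma stage_cost_le_dom_const:
  assumes "lam > 0" "\<bar>u\<bar> \<le> m" "\<bar>w\<bar> \<le> m" "\<bar>y'\<bar> \<le> \<bar>y\<bar> + 1"
  shows "lam * (u - y')\<^sup>2 + (w - u)\<^sup>2 \<le> dom_const lam m * (1 + y\<^sup>2)"
proof -
  have "\<bar>u - y'\<bar> \<le> (m + 1) + \<bar>y\<bar>"
    using assms by linarith
  then have "(u - y')\<^sup>2 \<le> ((m + 1) + \<bar>y\<bar>)\<^sup>2"
    using power_mono [of "\<bar>u - y'\<bar>" "(m + 1) + \<bar>y\<bar>" 2] by simp
  also have "\<dots> \<le> 2 * (m + 1)\<^sup>2 + 2 * y\<^sup>2"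
    using sum_squares_bound [of "m + 1" "\<bar>y\<bar>"] by (simp add: power2_sum)
  finally have 1: "lam * (u - y')\<^sup>2 \<le> lam * (2 * (m + 1)\<^sup>2 + 2 * y\<^sup>2)"
    using assms(1) by simp
  have "\<bar>w - u\<bar> \<le> 2 * m"
    using assms by linarith
  then have 2: "(w - u)\<^sup>2 \<le> 4 * m\<^sup>2"
    using power_mono [of "\<bar>w - u\<bar>" "2 * m" 2] by (simp add: power_mult_distrib)
  \<comment> \<open>The majorant equals the sum of the two bounds already found plus a nonnegative
    remainder.\<close>
  have "dom_const lam m * (1 + y\<^sup>2) = lam * (2 * (m + 1)\<^sup>2 + 2 * y\<^sup>2) + 4 * m\<^sup>2
      + (2 * lam + 4 * m\<^sup>2 * y\<^sup>2 + 2 * lam * (m + 1)\<^sup>2 * y\<^sup>2)"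
    by (simp add: dom_const_def algebra_simps)
  moreover have "0 \<le> 2 * lam + 4 * m\<^sup>2 * y\<^sup>2 + 2 * lam * (m + 1)\<^sup>2 * y\<^sup>2"
    using assms(1) by simp
  ultimately show ?thesis
    using 1 2 by linarith
qed

lemma mult_le_abs_bound:
  assumes "\<bar>u\<bar> \<le> m"
  shows "z * u \<le> m * \<bar>z :: real\<bar>"
proof -
  have "z * u \<le> \<bar>u\<bar> * \<bar>z\<bar>"
    by (metis abs_ge_self abs_mult mult.commute)
  also have "\<dots> \<le> m * \<bar>z\<bar>"
    using assms by (intro mult_right_mono) auto
  finally show ?thesis .
qed

lemma f_dens_le_exp:
  assumes "\<bar>u\<bar> \<le> m"
  shows "f_dens u z \<le> exp (m * \<bar>z\<bar>)"
  using mult_le_abs_bound [OF assms, of z] by (simp add: f_dens_def add_increasing field_simps)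

text \<open>The factor \<open>exp m\<close> absorbs the slack 1 allowed in \<open>z'\<close>, since
  the density is bounded by \<open>exp (m * (\<bar>z\<bar> + 1))\<close>. The bound is in terms of
  the exact observations and hence uniform over quantizers.\<close>

lemma c_red_le_dom:
  assumes "lam > 0" "\<bar>u\<bar> \<le> m" "\<bar>w\<bar> \<le> m" "\<bar>y'\<bar> \<le> \<bar>y\<bar> + 1" "\<bar>z'\<bar> \<le> \<bar>z\<bar> + 1"
  shows "c_red lam y' z' u w \<le> dom_const lam m * exp m * (1 + y\<^sup>2) * exp (m * \<bar>z\<bar>)"
proof -
  have m: "m \<ge> 0"
    using assms(2) by linarith
  have "f_dens u z' \<le> exp (m * \<bar>z'\<bar>)"
    using assms(2) by (rule f_dens_le_exp)
  also have "\<dots> \<le> exp (m * (\<bar>z\<bar> + 1))"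
    using assms(5) m by (simp add: mult_left_mono)
  finally have "c_red lam y' z' u w \<le> (dom_const lam m * (1 + y\<^sup>2)) * exp (m * (\<bar>z\<bar> + 1))"
    unfolding c_red_def
    using stage_cost_le_dom_const [OF assms(1-4)] assms(1) f_dens_pos [THEN less_imp_le]
    by (intro mult_mono) (auto simp: dom_const_def intro!: mult_nonneg_nonneg)
  then show ?thesis
    by (simp add: exp_add algebra_simps)
qed

lemma tendsto_c_red [tendsto_intros]:
  assumes "(a \<longlongrightarrow> y) F" "(b \<longlongrightarrow> z) F" "(g \<longlongrightarrow> u) F" "(h \<longlongrightarrow> w) F"
  shows "((\<lambda>x. c_red lam (a x) (b x) (g x) (h x)) \<longlongrightarrow> c_red lam y z u w) F"
  unfolding c_red_def f_dens_def by (intro tendsto_intros assms) simp_all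

text \<open>Dominated convergence in one form for two purposes: \<open>Q\<close> the identity, with
  policies that converge almost everywhere, and \<open>Q\<close> a quantizer, with policies composed
  with it. In the reduced cost each control depends on its own coordinate only, so the two
  almost-everywhere limits combine through \<open>AE_gauss2\<close>.\<close>

lemma nn_integral_c_red_tendsto:
  fixes Q U W :: "nat \<Rightarrow> real \<Rightarrow> real"
  assumes [measurable]: "\<And>k. Q k \<in> borel_measurable borel" "\<And>k. U k \<in> borel_measurable borel"
      "\<And>k. W k \<in> borel_measurable borel" "u \<in> borel_measurable borel" "w \<in> borel_measurable borel"
    and lam: "lam > 0"
    and bnd: "\<And>k y. \<bar>Q k y\<bar> \<le> \<bar>y\<bar> + 1" "\<And>k y. \<bar>U k y\<bar> \<le> m" "\<And>k y. \<bar>W k y\<bar> \<le> m"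
    and Q: "\<And>y. (\<lambda>k. Q k y) \<longlonglongrightarrow> y"
    and U: "AE y in std_normal_distribution. (\<lambda>k. U k y) \<longlonglongrightarrow> u y"
    and W: "AE z in std_normal_distribution. (\<lambda>k. W k z) \<longlonglongrightarrow> w z"
  shows "(\<lambda>k. \<integral>\<^sup>+(y, z). ennreal (c_red lam (Q k y) (Q k z) (U k y) (W k z)) \<partial>gauss2)
    \<longlonglongrightarrow> (\<integral>\<^sup>+(y, z). ennreal (c_red lam y z (u y) (w z)) \<partial>gauss2)"
proof (rule nn_integral_dominated_convergence
    [where w = "\<lambda>(y, z). ennreal (dom_const lam m * exp m * (1 + y\<^sup>2) * exp (m * \<bar>z\<bar>))"])
  show "(\<integral>\<^sup>+x. (case x of (y, z) \<Rightarrow>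
      ennreal (dom_const lam m * exp m * (1 + y\<^sup>2) * exp (m * \<bar>z\<bar>))) \<partial>gauss2) < \<infinity>"
    using lam by (intro nn_integral_gauss2_dominating) (simp add: dom_const_def)
  show "AE x in gauss2. (\<lambda>k. case x of (y, z) \<Rightarrow> ennreal (c_red lam (Q k y) (Q k z) (U k y) (W k z)))
      \<longlonglongrightarrow> (case x of (y, z) \<Rightarrow> ennreal (c_red lam y z (u y) (w z)))"
    using AE_gauss2 [OF U W] by eventually_elim (auto intro!: tendsto_intros tendsto_ennrealI Q)
  show "AE x in gauss2. (case x of (y, z) \<Rightarrow> ennreal (c_red lam (Q j y) (Q j z) (U j y) (W j z)))
      \<le> (case x of (y, z) \<Rightarrow> ennreal (dom_const lam m * exp m * (1 + y\<^sup>2) * exp (m * \<bar>z\<bar>)))" for j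
    using c_red_le_dom [OF lam bnd(2) bnd(3) bnd(1) bnd(1)] by (auto intro!: AE_I2 ennreal_leI)
qed measurable

subsection \<open>Reduction to bounded continuous policies\<close>

text \<open>Write \<open>g1 y\<close> as \<open>(g1 y - y) + y\<close>: the first summand is square
  integrable because its square times \<open>lam\<close> is part of the finite cost, the second
  because it is Gaussian.\<close>

lemma nn_integral_control_square:
  assumes [measurable]: "g1 \<in> borel_measurable borel" "g2 \<in> borel_measurable borel"
    and lam: "lam > 0" and fin: "W_cost lam g1 g2 < \<infinity>"
  shows "(\<integral>\<^sup>+(y, v). ennreal ((g1 y)\<^sup>2) \<partial>gauss2) < \<infinity>"
proof -
  \<comment> \<open>The nonnegative second-stage term is added so that the whole cost appears. The
    factor \<open>exp (0 * \<bar>v\<bar>)\<close> is 1 and only matches the shape of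
    \<open>nn_integral_gauss2_dominating\<close>.\<close>
  have le: "(g1 y)\<^sup>2 \<le> 2 / lam * (lam * (g1 y - y)\<^sup>2 + (g2 (g1 y + v) - g1 y)\<^sup>2)
      + 2 * (1 + y\<^sup>2) * exp (0 * \<bar>v\<bar>)" for y v
  proof -
    have "(g1 y)\<^sup>2 \<le> 2 * (g1 y - y)\<^sup>2 + 2 * y\<^sup>2"
      using sum_squares_bound [of "g1 y - y" y] power2_sum [of "g1 y - y" y] by simp
    moreover have "0 \<le> (g2 (g1 y + v) - g1 y)\<^sup>2 / lam"
      using lam by simp
    ultimately have "(g1 y)\<^sup>2 \<le> 2 * (g1 y - y)\<^sup>2 + 2 * ((g2 (g1 y + v) - g1 y)\<^sup>2 / lam)
        + (2 + 2 * y\<^sup>2)"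
      by linarith
    then show ?thesis
      using lam by (simp add: distrib_left)
  qed
  have "(\<integral>\<^sup>+(y, v). ennreal ((g1 y)\<^sup>2) \<partial>gauss2)
    \<le> (\<integral>\<^sup>+x. ennreal (2 / lam) * (case x of (y, v) \<Rightarrow>
            ennreal (lam * (g1 y - y)\<^sup>2 + (g2 (g1 y + v) - g1 y)\<^sup>2))
          + (case x of (y, v) \<Rightarrow> ennreal (2 * (1 + y\<^sup>2) * exp (0 * \<bar>v\<bar>))) \<partial>gauss2)"
    using lam le
    by (intro nn_integral_mono)
      (auto simp: ennreal_mult [symmetric] ennreal_plus [symmetric] simp del: ennreal_plus)
  also have "\<dots> = ennreal (2 / lam) * W_cost lam g1 g2
      + (\<integral>\<^sup>+(y, v). ennreal (2 * (1 + y\<^sup>2) * exp (0 * \<bar>v\<bar>)) \<partial>gauss2)"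
    unfolding W_cost_def Let_def by (subst nn_integral_add) (auto simp: nn_integral_cmult)
  also have "\<dots> < \<infinity>"
    using fin nn_integral_gauss2_dominating [of 2 0] by (simp add: ennreal_mult_less_top)
  finally show ?thesis .
qed

section \<open>Truncation of policies of finite cost\<close>

definition trunc :: "nat \<Rightarrow> real \<Rightarrow> real" where
  "trunc k x = (if \<bar>x\<bar> \<le> real k then x else 0)"

lemma borel_measurable_trunc [measurable]: "trunc k \<in> borel_measurable borel"
  unfolding trunc_def by measurable

lemma trunc_le: "\<bar>trunc k x\<bar> \<le> real k"
  by (simp add: trunc_def)

lemma trunc_square_le: "(trunc k x)\<^sup>2 \<le> x\<^sup>2"
  by (simp add: trunc_def)

lemma eventually_trunc_eq: "\<forall>\<^sub>F k in sequentially. trunc k x = x"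
proof -
  obtain N where N: "\<bar>x\<bar> \<le> real N"
    using real_arch_simple by blast
  then show ?thesis
    by (intro eventually_sequentiallyI [of N]) (auto simp: trunc_def)
qed

lemma square_diff_le: "(a - b)\<^sup>2 \<le> 2 * a\<^sup>2 + 2 * (b::real)\<^sup>2"
  using sum_squares_bound [of a "-b"] power2_sum [of a "-b"] by simp

text \<open>Since \<open>trunc\<close> replaces large values by 0, the second-stage cost after
  truncation is either the original one or the square of \<open>g1 y\<close>. The sum of the
  original cost and that square therefore dominates. The observation of the second agent is not
  affected by this truncation.\<close>

lemma W_cost_trunc_second_tendsto:
  assumes [measurable]: "g1 \<in> borel_measurable borel" "g2 \<in> borel_measurable borel"
    and lam: "lam > 0" and fin: "W_cost lam g1 g2 < \<infinity>"
  shows "(\<lambda>k. W_cost lam g1 (\<lambda>z. trunc k (g2 z))) \<longlonglongrightarrow> W_cost lam g1 g2"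
  unfolding W_cost_def Let_def
proof (rule nn_integral_dominated_convergence
    [where w = "\<lambda>x. (case x of (y, v) \<Rightarrow> ennreal (lam * (g1 y - y)\<^sup>2 + (g2 (g1 y + v) - g1 y)\<^sup>2))
        + (case x of (y, v) \<Rightarrow> ennreal ((g1 y)\<^sup>2))"])
  show "(\<integral>\<^sup>+x. (case x of (y, v) \<Rightarrow> ennreal (lam * (g1 y - y)\<^sup>2 + (g2 (g1 y + v) - g1 y)\<^sup>2))
        + (case x of (y, v) \<Rightarrow> ennreal ((g1 y)\<^sup>2)) \<partial>gauss2) < \<infinity>"
    using fin nn_integral_control_square [OF assms]
    by (subst nn_integral_add) (auto simp: W_cost_def Let_def)
  show "AE x in gauss2. (\<lambda>k. case x of (y, v) \<Rightarrow>
         ennreal (lam * (g1 y - y)\<^sup>2 + (trunc k (g2 (g1 y + v)) - g1 y)\<^sup>2))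
      \<longlonglongrightarrow> (case x of (y, v) \<Rightarrow> ennreal (lam * (g1 y - y)\<^sup>2 + (g2 (g1 y + v) - g1 y)\<^sup>2))"
  proof (intro AE_I2, clarify)
    fix y v
    show "(\<lambda>k. ennreal (lam * (g1 y - y)\<^sup>2 + (trunc k (g2 (g1 y + v)) - g1 y)\<^sup>2))
      \<longlonglongrightarrow> ennreal (lam * (g1 y - y)\<^sup>2 + (g2 (g1 y + v) - g1 y)\<^sup>2)"
      by (rule tendsto_eventually)
        (use eventually_trunc_eq [of "g2 (g1 y + v)"] in eventually_elim, simp)
  qed
  show "AE x in gauss2. (case x of (y, v) \<Rightarrow>
         ennreal (lam * (g1 y - y)\<^sup>2 + (trunc k (g2 (g1 y + v)) - g1 y)\<^sup>2))
      \<le> (case x of (y, v) \<Rightarrow> ennreal (lam * (g1 y - y)\<^sup>2 + (g2 (g1 y + v) - g1 y)\<^sup>2))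
        + (case x of (y, v) \<Rightarrow> ennreal ((g1 y)\<^sup>2))" for k
    using lam
    by (auto intro!: AE_I2 ennreal_leI simp: ennreal_plus [symmetric] trunc_def
        simp del: ennreal_plus)
qed measurable

text \<open>Truncating the first control also changes the observation passed to \<open>g2\<close>,
  so the original cost does not control the new second-stage term; the bound \<open>b\<close> does.
  For each \<open>y\<close> the truncated control is eventually equal to \<open>g1 y\<close>, hence
  so is the observation, and the integrand is eventually constant in \<open>k\<close>.\<close>

lemma W_cost_trunc_first_tendsto:
  assumes [measurable]: "g1 \<in> borel_measurable borel" "g2 \<in> borel_measurable borel"
    and lam: "lam > 0" and fin: "W_cost lam g1 g2 < \<infinity>" and b: "\<And>z. \<bar>g2 z\<bar> \<le> b"
  shows "(\<lambda>k. W_cost lam (\<lambda>y. trunc k (g1 y)) g2) \<longlonglongrightarrow> W_cost lam g1 g2"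
  unfolding W_cost_def Let_def
proof (rule nn_integral_dominated_convergence
    [where w = "\<lambda>x. ennreal (2 * lam + 2) * (case x of (y, v) \<Rightarrow> ennreal ((g1 y)\<^sup>2))
      + (case x of (y, v) \<Rightarrow> ennreal ((2 * lam + 2 * b\<^sup>2) * (1 + y\<^sup>2) * exp (0 * \<bar>v\<bar>)))"])
  show "(\<integral>\<^sup>+x. ennreal (2 * lam + 2) * (case x of (y, v) \<Rightarrow> ennreal ((g1 y)\<^sup>2))
      + (case x of (y, v) \<Rightarrow> ennreal ((2 * lam + 2 * b\<^sup>2) * (1 + y\<^sup>2) * exp (0 * \<bar>v\<bar>)))
      \<partial>gauss2) < \<infinity>"
    using lam nn_integral_control_square [OF assms(1-4)]
      nn_integral_gauss2_dominating [of "2 * lam + 2 * b\<^sup>2" 0]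
    by (subst nn_integral_add) (auto simp: nn_integral_cmult ennreal_mult_less_top)
  show "AE x in gauss2. (\<lambda>k. case x of (y, v) \<Rightarrow>
         ennreal (lam * (trunc k (g1 y) - y)\<^sup>2 + (g2 (trunc k (g1 y) + v) - trunc k (g1 y))\<^sup>2))
      \<longlonglongrightarrow> (case x of (y, v) \<Rightarrow> ennreal (lam * (g1 y - y)\<^sup>2 + (g2 (g1 y + v) - g1 y)\<^sup>2))"
  proof (intro AE_I2, clarify)
    fix y v
    show "(\<lambda>k. ennreal (lam * (trunc k (g1 y) - y)\<^sup>2 + (g2 (trunc k (g1 y) + v) - trunc k (g1 y))\<^sup>2))
      \<longlonglongrightarrow> ennreal (lam * (g1 y - y)\<^sup>2 + (g2 (g1 y + v) - g1 y)\<^sup>2)"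
      by (rule tendsto_eventually)
        (use eventually_trunc_eq [of "g1 y"] in eventually_elim, simp)
  qed
  show "AE x in gauss2. (case x of (y, v) \<Rightarrow>
         ennreal (lam * (trunc k (g1 y) - y)\<^sup>2 + (g2 (trunc k (g1 y) + v) - trunc k (g1 y))\<^sup>2))
      \<le> ennreal (2 * lam + 2) * (case x of (y, v) \<Rightarrow> ennreal ((g1 y)\<^sup>2))
      + (case x of (y, v) \<Rightarrow> ennreal ((2 * lam + 2 * b\<^sup>2) * (1 + y\<^sup>2) * exp (0 * \<bar>v\<bar>)))" for k
  proof (intro AE_I2, clarify)
    fix y v :: real
    let ?u = "trunc k (g1 y)" and ?w = "g2 (trunc k (g1 y) + v)"
    have "(?u - y)\<^sup>2 \<le> 2 * (g1 y)\<^sup>2 + 2 * y\<^sup>2"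
      using square_diff_le [of ?u y] trunc_square_le [of k "g1 y"] by linarith
    then have 1: "lam * (?u - y)\<^sup>2 \<le> lam * (2 * (g1 y)\<^sup>2 + 2 * y\<^sup>2)"
      using lam by simp
    have "?w\<^sup>2 \<le> b\<^sup>2"
      using b [of "trunc k (g1 y) + v"] power_mono [of "\<bar>?w\<bar>" b 2] by simp
    then have 2: "(?w - ?u)\<^sup>2 \<le> 2 * b\<^sup>2 + 2 * (g1 y)\<^sup>2"
      using square_diff_le [of ?w ?u] trunc_square_le [of k "g1 y"] by linarith
    have "(2 * lam + 2) * (g1 y)\<^sup>2 + (2 * lam + 2 * b\<^sup>2) * (1 + y\<^sup>2) * exp (0 * \<bar>v\<bar>)
      = lam * (2 * (g1 y)\<^sup>2 + 2 * y\<^sup>2) + (2 * b\<^sup>2 + 2 * (g1 y)\<^sup>2) + (2 * lam + 2 * (b\<^sup>2 * y\<^sup>2))"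
      by (simp add: algebra_simps)
    moreover have "0 \<le> b\<^sup>2 * y\<^sup>2"
      by simp
    ultimately have "lam * (?u - y)\<^sup>2 + (?w - ?u)\<^sup>2
      \<le> (2 * lam + 2) * (g1 y)\<^sup>2 + (2 * lam + 2 * b\<^sup>2) * (1 + y\<^sup>2) * exp (0 * \<bar>v\<bar>)"
      using 1 2 lam by linarith
    then show "ennreal (lam * (?u - y)\<^sup>2 + (?w - ?u)\<^sup>2) \<le> ennreal (2 * lam + 2) * ennreal ((g1 y)\<^sup>2)
      + ennreal ((2 * lam + 2 * b\<^sup>2) * (1 + y\<^sup>2) * exp (0 * \<bar>v\<bar>))"
      using lam
      by (simp add: ennreal_mult [symmetric] ennreal_plus [symmetric] del: ennreal_plus)
  qed
qed measurable

lemma bounded_policies_near_optimal: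
  assumes lam: "lam > 0" and r: "W_opt lam < r"
  obtains g1 g2 m where "g1 \<in> borel_measurable borel" "g2 \<in> borel_measurable borel"
    "m > 0" "\<And>y. \<bar>g1 y\<bar> \<le> m" "\<And>z. \<bar>g2 z\<bar> \<le> m" "W_cost lam g1 g2 < r"
proof -
  obtain g1 g2 where [measurable]: "g1 \<in> borel_measurable borel" "g2 \<in> borel_measurable borel"
    and cost: "W_cost lam g1 g2 < r"
    using r unfolding W_opt_def by (auto simp: INF_less_iff)
  have "W_cost lam g1 g2 < \<infinity>"
    using cost by (simp add: order_less_le_trans)
  then have "(\<lambda>k. W_cost lam g1 (\<lambda>z. trunc k (g2 z))) \<longlonglongrightarrow> W_cost lam g1 g2"
    using lam by (intro W_cost_trunc_second_tendsto) auto
  from order_tendstoD(2) [OF this cost] obtain k where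
    cost': "W_cost lam g1 (\<lambda>z. trunc k (g2 z)) < r"
    by (auto simp: eventually_sequentially)
  then have "W_cost lam g1 (\<lambda>z. trunc k (g2 z)) < \<infinity>"
    by (simp add: order_less_le_trans)
  then have "(\<lambda>j. W_cost lam (\<lambda>y. trunc j (g1 y)) (\<lambda>z. trunc k (g2 z)))
      \<longlonglongrightarrow> W_cost lam g1 (\<lambda>z. trunc k (g2 z))"
    using lam trunc_le by (intro W_cost_trunc_first_tendsto [where b = "real k"]) auto
  from order_tendstoD(2) [OF this cost'] obtain j where
    cost'': "W_cost lam (\<lambda>y. trunc j (g1 y)) (\<lambda>z. trunc k (g2 z)) < r"
    by (auto simp: eventually_sequentially)
  show ?thesis
  proof (rule that)
    \<comment> \<open>A common bound for both policies; the successor keeps it positive when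
      \<open>j\<close> and \<open>k\<close> are both 0.\<close>
    show "\<bar>trunc j (g1 y)\<bar> \<le> real (Suc (j + k))" for y
      using trunc_le [of j "g1 y"] by simp
    show "\<bar>trunc k (g2 z)\<bar> \<le> real (Suc (j + k))" for z
      using trunc_le [of k "g2 z"] by simp
  qed (use cost'' in auto)
qed

section \<open>Approximation by continuous policies\<close>

lemma continuous_approx_gauss_AE:
  fixes g :: "real \<Rightarrow> real"
  assumes [measurable]: "g \<in> borel_measurable borel" and m: "\<And>y. \<bar>g y\<bar> \<le> m"
  obtains h :: "nat \<Rightarrow> real \<Rightarrow> real" where "\<And>k. continuous_on UNIV (h k)" "\<And>k y. \<bar>h k y\<bar> \<le> m"
    "AE y in std_normal_distribution. (\<lambda>k. h k y) \<longlonglongrightarrow> g y"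
proof -
  \<comment> \<open>By definition, \<open>measurable_on\<close> means being the limit of continuous
    functions outside a negligible set.\<close>
  have "g measurable_on UNIV"
    by (rule lebesgue_measurable_imp_measurable_on) (auto simp: measurable_completion)
  then obtain N h where N: "negligible N" and h: "\<And>k. continuous_on UNIV (h k)"
    and lim: "\<And>y. y \<notin> N \<Longrightarrow> (\<lambda>k. h k y) \<longlonglongrightarrow> g y"
    unfolding measurable_on_def by auto
  have m0: "m \<ge> 0"
    using m [of 0] by linarith
  \<comment> \<open>Clamping to \<open>[-m, m]\<close> preserves continuity, and it preserves the
    limit because \<open>g\<close> already takes values there.\<close>
  define c where "c = (\<lambda>k y. max (- m) (min m (h k y)))"
  \<comment> \<open>The Gaussian law has a density with respect to \<open>lborel\<close>, so
    Lebesgue null sets are Gaussian null sets.\<close>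
  have "AE y in lebesgue. y \<notin> N"
    using N by (intro AE_not_in) (simp add: negligible_iff_null_sets)
  then have "AE y in lborel. y \<notin> N"
    by (simp add: AE_completion_iff)
  then have "AE y in std_normal_distribution. y \<notin> N"
    by (auto simp: AE_density)
  then have ae: "AE y in std_normal_distribution. (\<lambda>k. c k y) \<longlonglongrightarrow> g y"
  proof eventually_elim
    fix y
    assume "y \<notin> N"
    then have "(\<lambda>k. c k y) \<longlonglongrightarrow> max (- m) (min m (g y))"
      unfolding c_def by (intro tendsto_intros lim)
    then show "(\<lambda>k. c k y) \<longlonglongrightarrow> g y"
      using m [of y] by (simp add: abs_le_iff)
  qed
  show ?thesis
  proof (rule that [of c, OF _ _ ae])
    show "continuous_on UNIV (c k)" for k
      unfolding c_def by (intro continuous_intros h)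
    show "\<bar>c k y\<bar> \<le> m" for k y
      using m0 by (auto simp: c_def)
  qed
qed

lemma continuous_policies_near_optimal:
  assumes lam: "lam > 0" and r: "W_opt lam < r"
  obtains g1 g2 m where "continuous_on UNIV g1" "continuous_on UNIV g2"
    "m > 0" "\<And>y. \<bar>g1 y\<bar> \<le> m" "\<And>z. \<bar>g2 z\<bar> \<le> m" "W_cost lam g1 g2 < r"
proof -
  obtain g1 g2 m where [measurable]: "g1 \<in> borel_measurable borel" "g2 \<in> borel_measurable borel"
    and m: "m > 0" "\<And>y. \<bar>g1 y\<bar> \<le> m" "\<And>z. \<bar>g2 z\<bar> \<le> m" and cost: "W_cost lam g1 g2 < r"
    using bounded_policies_near_optimal [OF assms] by blast
  obtain h1 where h1: "\<And>k. continuous_on UNIV (h1 k)" "\<And>k y. \<bar>h1 k y\<bar> \<le> m"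
    "AE y in std_normal_distribution. (\<lambda>k. h1 k y) \<longlonglongrightarrow> g1 y"
    using continuous_approx_gauss_AE [of g1 m] m by auto
  obtain h2 where h2: "\<And>k. continuous_on UNIV (h2 k)" "\<And>k y. \<bar>h2 k y\<bar> \<le> m"
    "AE y in std_normal_distribution. (\<lambda>k. h2 k y) \<longlonglongrightarrow> g2 y"
    using continuous_approx_gauss_AE [of g2 m] m by auto
  have [measurable]: "h1 k \<in> borel_measurable borel" "h2 k \<in> borel_measurable borel" for k
    using h1 h2 by (auto intro: borel_measurable_continuous_onI)
  \<comment> \<open>The limit is taken in the reduced form: in the original one the second policy is
    evaluated at \<open>h1 k y + v\<close>, a point that moves with \<open>k\<close>, where
    pointwise almost-everywhere convergence of \<open>h2\<close> gives no direct limit.\<close>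
  have "(\<lambda>k. \<integral>\<^sup>+(y, z). ennreal (c_red lam y z (h1 k y) (h2 k z)) \<partial>gauss2)
    \<longlonglongrightarrow> (\<integral>\<^sup>+(y, z). ennreal (c_red lam y z (g1 y) (g2 z)) \<partial>gauss2)"
    using lam h1(2,3) h2(2,3)
    by (intro nn_integral_c_red_tendsto [where Q = "\<lambda>_ y. y" and m = m]) auto
  then have "(\<lambda>k. W_cost lam (h1 k) (h2 k)) \<longlonglongrightarrow> W_cost lam g1 g2"
    using lam by (simp add: W_cost_c_red)
  from order_tendstoD(2) [OF this cost] obtain k where "W_cost lam (h1 k) (h2 k) < r"
    by (auto simp: eventually_sequentially)
  then show ?thesis
    using that h1 h2 m by metis
qed

text \<open>The zero policies cost \<open>lam\<close> times the second moment of \<open>y\<close>.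
  Finiteness makes \<open>W_opt lam\<close> plus a positive number strictly larger than
  \<open>W_opt lam\<close>.\<close>

lemma W_opt_finite: "lam > 0 \<Longrightarrow> W_opt lam < \<infinity>"
proof -
  assume lam: "lam > 0"
  have "W_opt lam \<le> W_cost lam (\<lambda>_. 0) (\<lambda>_. 0)"
    unfolding W_opt_def by (rule INF_lower2 [of "(\<lambda>_. 0, \<lambda>_. 0)"]) auto
  also have "\<dots> \<le> (\<integral>\<^sup>+(y, z). ennreal (lam * (1 + y\<^sup>2) * exp (0 * \<bar>z\<bar>)) \<partial>gauss2)"
    using lam unfolding W_cost_def Let_def by (intro nn_integral_mono) (auto intro!: ennreal_leI)
  also have "\<dots> < \<infinity>"
    using lam by (intro nn_integral_gauss2_dominating) simp
  finally show ?thesis .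
qed

subsection \<open>The quantizer\<close>

lemma q_step_pos: "l > 0 \<Longrightarrow> n \<ge> 1 \<Longrightarrow> q_step l n > 0"
  by (simp add: q_step_def)

text \<open>Cell \<open>j\<close> runs from \<open>- l + (j - 1) * q_step l n\<close> up to but
  excluding \<open>- l + j * q_step l n\<close>. The floor form settles existence and uniqueness of
  the cell index at once.\<close>

lemma mem_q_cell_iff_floor:
  assumes "l > 0" "n \<ge> 1"
  shows "y \<in> q_cell l n j \<longleftrightarrow> \<lfloor>(y + l) / q_step l n\<rfloor> = int j - 1"
proof -
  let ?t = "q_step l n"
  have t: "?t > 0"
    using assms by (rule q_step_pos)
  have lo: "q_level l n j - ?t / 2 = - l + (real j - 1) * ?t"
    and hi: "q_level l n j + ?t / 2 = - l + real j * ?t"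
    by (simp_all add: q_level_def algebra_simps)
  have "\<lfloor>(y + l) / ?t\<rfloor> = int j - 1 \<longleftrightarrow> real j - 1 \<le> (y + l) / ?t \<and> (y + l) / ?t < real j"
    by (subst floor_eq_iff) auto
  also have "\<dots> \<longleftrightarrow> y \<in> q_cell l n j"
    unfolding q_cell_def lo hi using t by (auto simp: pos_le_divide_eq pos_divide_less_eq)
  finally show ?thesis ..
qed

lemma quantizer_eq_level:
  assumes l: "l > 0" and n: "n \<ge> 1" and y: "- l \<le> y" "y < l"
  obtains j where "j \<in> {1..n}" "y \<in> q_cell l n j" "quantizer l n y = q_level l n j"
    "int j - 1 = \<lfloor>(y + l) / q_step l n\<rfloor>"
proof -
  let ?t = "q_step l n"
  define k where "k = \<lfloor>(y + l) / ?t\<rfloor>"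
  have t: "?t > 0"
    using l n by (rule q_step_pos)
  have k0: "k \<ge> 0"
    using t y by (simp add: k_def)
  \<comment> \<open>The interval has length \<open>2 * l\<close>, which is exactly \<open>n\<close>
    steps; the strict bound keeps the index at most \<open>n\<close>.\<close>
  have "(y + l) / ?t < real n"
    using t y n by (simp add: pos_divide_less_eq) (simp add: q_step_def)
  then have kn: "k < int n"
    by (simp add: k_def floor_less_iff)
  define j where "j = nat (k + 1)"
  have jk: "int j - 1 = k"
    using k0 by (simp add: j_def)
  have j: "j \<in> {1..n}"
    using k0 kn by (auto simp: j_def)
  have cell: "y \<in> q_cell l n j"
    using mem_q_cell_iff_floor [OF l n] jk k_def by simp
  have "(THE i. i \<in> {1..n} \<and> y \<in> q_cell l n i) = j"
  proof (rule the_equality)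
    show "i = j" if "i \<in> {1..n} \<and> y \<in> q_cell l n i" for i
      using that mem_q_cell_iff_floor [OF l n] cell by (metis diff_add_cancel of_nat_eq_iff)
  qed (use j cell in simp)
  then have "quantizer l n y = q_level l n j"
    using y by (simp add: quantizer_def)
  with that j cell jk show ?thesis
    by (simp add: k_def)
qed

text \<open>This closed form eliminates the definite description, so that measurability can be read
  off.\<close>

lemma quantizer_floor:
  assumes "l > 0" "n \<ge> 1"
  shows "quantizer l n y = (if y < - l \<or> y > l then 0 else if y = l then q_level l n n
    else - l + (of_int \<lfloor>(y + l) / q_step l n\<rfloor> + 1 / 2) * q_step l n)"
proof (cases "- l \<le> y \<and> y < l")
  case True
  then obtain j where j: "quantizer l n y = q_level l n j" "int j - 1 = \<lfloor>(y + l) / q_step l n\<rfloor>"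
    using quantizer_eq_level [OF assms, of y] by blast
  have "real j - 1 / 2 = of_int \<lfloor>(y + l) / q_step l n\<rfloor> + 1 / 2"
    unfolding j(2) [symmetric] by simp
  then have "quantizer l n y = - l + (of_int \<lfloor>(y + l) / q_step l n\<rfloor> + 1 / 2) * q_step l n"
    unfolding j(1) q_level_def by (simp only:)
  then show ?thesis
    using True by simp
next
  case False
  then show ?thesis
    using assms(1) by (cases "y < - l"; cases "y = l") (simp_all add: quantizer_def)
qed

lemma borel_measurable_quantizer:
  assumes "l > 0" "n \<ge> 1"
  shows "quantizer l n \<in> borel_measurable borel"
  by (subst measurable_cong [OF quantizer_floor [OF assms]]) measurable

lemma finite_Z_fin: "finite (Z_fin l n)"
  by (simp add: Z_fin_def)

lemma quantizer_in_Z_fin: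
  assumes "l > 0" "n \<ge> 1"
  shows "quantizer l n y \<in> Z_fin l n"
proof (cases "- l \<le> y \<and> y < l")
  case True
  then obtain j where "j \<in> {1..n}" "quantizer l n y = q_level l n j"
    using quantizer_eq_level [OF assms, of y] by blast
  then show ?thesis
    by (simp add: Z_fin_def)
next
  case False
  then have "y = l \<or> y \<notin> {-l..l}"
    by auto
  then show ?thesis
    using assms by (auto simp: quantizer_def Z_fin_def)
qed

lemma quantizer_error:
  assumes l: "l > 0" and n: "n \<ge> 1" and y: "\<bar>y\<bar> \<le> l"
  shows "\<bar>quantizer l n y - y\<bar> \<le> q_step l n / 2"
proof (cases "y = l")
  case True
  \<comment> \<open>The endpoint \<open>l\<close> lies in none of the half-open cells
    \<open>1..n\<close>; its assigned level is still only half a step away.\<close>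
  have "q_level l n n = l - q_step l n / 2"
    using n by (simp add: q_level_def q_step_def field_simps)
  moreover have "quantizer l n y = q_level l n n"
    using True l by (simp add: quantizer_def)
  ultimately show ?thesis
    using True q_step_pos [OF l n] by simp
next
  case False
  with y have "- l \<le> y" "y < l"
    by auto
  then obtain j where "y \<in> q_cell l n j" "quantizer l n y = q_level l n j"
    using quantizer_eq_level [OF l n] by blast
  then have "q_level l n j - q_step l n / 2 \<le> y" "y < q_level l n j + q_step l n / 2"
      "quantizer l n y = q_level l n j"
    by (simp_all add: q_cell_def)
  then show ?thesis
    by linarith
qed

text \<open>The range \<open>l = k + 1\<close> tends to infinity while the step \<open>2 l / n = 2 / (k + 1)\<close> tends to 0.\<close>

definition rate_quantizer :: "nat \<Rightarrow> real \<Rightarrow> real" where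
  "rate_quantizer k = quantizer (real (Suc k)) ((Suc k)\<^sup>2)"

lemma rate_quantizer_error:
  assumes "\<bar>y\<bar> \<le> real (Suc k)"
  shows "\<bar>rate_quantizer k y - y\<bar> \<le> 1 / real (Suc k)"
proof -
  have "q_step (real (Suc k)) ((Suc k)\<^sup>2) / 2 = 1 / real (Suc k)"
    unfolding q_step_def of_nat_power by (simp add: power2_eq_square del: of_nat_Suc)
  then show ?thesis
    using quantizer_error [of "real (Suc k)" "(Suc k)\<^sup>2" y] assms
    by (simp add: rate_quantizer_def del: of_nat_Suc)
qed

text \<open>Inside the range the error is at most \<open>1 / Suc k\<close>, hence at most 1;
  outside, the value is 0. The bound is uniform in \<open>k\<close>, as domination requires.\<close>

lemma abs_rate_quantizer_le: "\<bar>rate_quantizer k y\<bar> \<le> \<bar>y\<bar> + 1"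
proof (cases "\<bar>y\<bar> \<le> real (Suc k)")
  case True
  moreover have "1 / real (Suc k) \<le> 1"
    by simp
  ultimately show ?thesis
    using rate_quantizer_error [of y k] by linarith
next
  case False
  then have "rate_quantizer k y = 0"
    by (auto simp: rate_quantizer_def quantizer_def)
  then show ?thesis
    by simp
qed

lemma rate_quantizer_tendsto: "(\<lambda>k. rate_quantizer k y) \<longlonglongrightarrow> y"
proof -
  have "(\<lambda>k. rate_quantizer k y - y) \<longlonglongrightarrow> 0"
  proof (rule Lim_null_comparison)
    obtain N where N: "\<bar>y\<bar> \<le> real N"
      using real_arch_simple by blast
    show "\<forall>\<^sub>F k in sequentially. norm (rate_quantizer k y - y) \<le> 1 / real (Suc k)"
      using N by (intro eventually_sequentiallyI [of N]) (simp add: rate_quantizer_error del: of_nat_Suc)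
    show "(\<lambda>k. 1 / real (Suc k)) \<longlonglongrightarrow> 0"
      using LIMSEQ_inverse_real_of_nat by (simp add: inverse_eq_divide)
  qed
  then show ?thesis
    by (simp add: LIM_zero_iff)
qed

lemma borel_measurable_rate_quantizer [measurable]: "rate_quantizer k \<in> borel_measurable borel"
  unfolding rate_quantizer_def by (rule borel_measurable_quantizer) auto

subsection \<open>The finite cost as an integral\<close>

text \<open>Finitely many values with measurable fibres make \<open>q\<close> simple, and composing
  a simple function with any \<open>p\<close> leaves it simple. Thus every finite-model policy
  extends to a measurable one.\<close>

lemma borel_measurable_compose_finite_range:
  fixes q :: "'a \<Rightarrow> 'b::t1_space"
  assumes q: "q \<in> borel_measurable M" and Z: "finite Z" "\<And>x. q x \<in> Z"
  shows "(\<lambda>x. p (q x)) \<in> borel_measurable M"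
proof (rule borel_measurable_simple_function)
  have "simple_function M q"
    unfolding simple_function_def
  proof
    show "finite (q ` space M)"
      using Z by (meson finite_subset image_subsetI)
    show "\<forall>x\<in>q ` space M. q -` {x} \<inter> space M \<in> sets M"
      using q by (auto intro!: measurable_sets [of q M borel])
  qed
  then show "simple_function M (\<lambda>x. p (q x))"
    by (rule simple_function_compose1)
qed

lemma nn_integral_compose_finite_range:
  fixes q :: "real \<Rightarrow> real"
  assumes q [measurable]: "q \<in> borel_measurable borel" and Z: "finite Z" "\<And>x. q x \<in> Z"
    and F: "\<And>z. z \<in> Z \<Longrightarrow> F z \<ge> (0::real)"
  shows "(\<integral>\<^sup>+x. ennreal (F (q x)) \<partial>std_normal_distribution)
    = ennreal (\<Sum>z\<in>Z. F z * measure std_normal_distribution (q -` {z}))"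
proof -
  have [measurable]: "q -` {z} \<in> sets borel" for z
    using measurable_sets [OF q, of "{z}"] by simp
  have "(\<integral>\<^sup>+x. ennreal (F (q x)) \<partial>std_normal_distribution)
    = (\<integral>\<^sup>+x. (\<Sum>z\<in>Z. ennreal (F z) * indicator (q -` {z}) x) \<partial>std_normal_distribution)"
  proof (rule nn_integral_cong)
    fix x :: real
    \<comment> \<open>The fibres of \<open>q\<close> partition the line, so only the term
      \<open>z = q x\<close> survives.\<close>
    have "(\<Sum>z\<in>Z. ennreal (F z) * indicator (q -` {z}) x) = (\<Sum>z\<in>{q x}. ennreal (F z))"
      using Z by (intro sum.mono_neutral_cong_right) (auto simp: indicator_def)
    then show "ennreal (F (q x)) = (\<Sum>z\<in>Z. ennreal (F z) * indicator (q -` {z}) x)"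
      by simp
  qed
  also have "\<dots> = (\<Sum>z\<in>Z. ennreal (F z) * emeasure std_normal_distribution (q -` {z}))"
    by (subst nn_integral_sum) (auto simp: nn_integral_cmult_indicator)
  also have "\<dots> = (\<Sum>z\<in>Z. ennreal (F z * measure std_normal_distribution (q -` {z})))"
    using F by (intro sum.cong) (auto simp: gauss.emeasure_eq_measure ennreal_mult)
  also have "\<dots> = ennreal (\<Sum>z\<in>Z. F z * measure std_normal_distribution (q -` {z}))"
    using F by (intro sum_ennreal) auto
  finally show ?thesis .
qed

text \<open>\<open>P_fin\<close> is the image of the Gaussian law under the quantizer, so the double
  sum is an iterated integral. Compared with the true cost of the extended policies, the integrand
  has the same controls and differs only in the observations inserted into
  \<open>c_red\<close>.\<close>

lemma J_fin_nn_integral: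
  fixes p1 p2 :: "real \<Rightarrow> real"
  assumes lam: "lam > 0" and l: "l > 0" and n: "n \<ge> 1"
  defines "q \<equiv> quantizer l n"
  shows "ennreal (J_fin lam l n p1 p2)
    = (\<integral>\<^sup>+(y, z). ennreal (c_red lam (q y) (q z) ((p1 \<circ> q) y) ((p2 \<circ> q) z)) \<partial>gauss2)"
proof -
  note Z = finite_Z_fin quantizer_in_Z_fin [OF l n]
  have q [measurable]: "q \<in> borel_measurable borel"
    unfolding q_def using l n by (rule borel_measurable_quantizer)
  have [measurable]: "(\<lambda>y. p1 (q y)) \<in> borel_measurable borel"
      "(\<lambda>y. p2 (q y)) \<in> borel_measurable borel"
    using borel_measurable_compose_finite_range [OF q Z(1) Z(2) [folded q_def]] by blast+
  let ?F = "\<lambda>z. \<Sum>z'\<in>Z_fin l n. c_red lam z z' (p1 z) (p2 z') * P_fin l n z'"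
  have "(\<integral>\<^sup>+(y, z). ennreal (c_red lam (q y) (q z) ((p1 \<circ> q) y) ((p2 \<circ> q) z)) \<partial>gauss2)
     = (\<integral>\<^sup>+y. \<integral>\<^sup>+z. ennreal (c_red lam (q y) (q z) ((p1 \<circ> q) y) ((p2 \<circ> q) z))
          \<partial>std_normal_distribution \<partial>std_normal_distribution)"
    by (subst gauss.nn_integral_fst [symmetric]) auto
  also have "\<dots> = (\<integral>\<^sup>+y. ennreal (?F (q y)) \<partial>std_normal_distribution)"
  proof (rule nn_integral_cong)
    fix y :: real
    show "(\<integral>\<^sup>+z. ennreal (c_red lam (q y) (q z) ((p1 \<circ> q) y) ((p2 \<circ> q) z)) \<partial>std_normal_distribution)
      = ennreal (?F (q y))"
      using nn_integral_compose_finite_range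
          [of q "Z_fin l n" "\<lambda>z. c_red lam (q y) z (p1 (q y)) (p2 z)"]
        q Z lam by (simp add: q_def P_fin_def c_red_nonneg)
  qed
  also have "\<dots> = ennreal (\<Sum>z\<in>Z_fin l n. ?F z * P_fin l n z)"
    using nn_integral_compose_finite_range [of q "Z_fin l n" ?F] q Z lam
    by (simp add: q_def P_fin_def c_red_nonneg sum_nonneg)
  also have "\<dots> = ennreal (J_fin lam l n p1 p2)"
    by (simp add: J_fin_def sum_distrib_right mult.assoc mult.left_commute)
      (simp add: mult.commute mult.left_commute)
  finally show ?thesis ..
qed

subsection \<open>Uniform quantization error\<close>

text \<open>The first summand bounds the change of the stage cost times the density, the second
  bounds the stage cost times the change of the density. The controls enter only through their bound
  \<open>m\<close>.\<close>

definition quant_err :: "real \<Rightarrow> real \<Rightarrow> real \<Rightarrow> real \<Rightarrow> real \<Rightarrow> real \<Rightarrow> real" where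
  "quant_err lam m y y' z z' =
    lam * (\<bar>y - y'\<bar> * (2 * m + \<bar>y\<bar> + \<bar>y'\<bar>)) * exp (m * \<bar>z\<bar>)
    + dom_const lam m * (1 + y\<^sup>2) * (m * \<bar>z - z'\<bar> * exp (m * (\<bar>z\<bar> + \<bar>z'\<bar>)))"

text \<open>A mean-value bound, obtained from the tangent inequality
  \<open>1 + x \<le> exp x\<close> by factoring out the larger exponential.\<close>

lemma abs_exp_diff_le: "\<bar>exp a - exp b\<bar> \<le> \<bar>a - b\<bar> * exp (max a (b::real))"
proof -
  have *: "exp t - exp s \<le> (t - s) * exp t" for s t :: real
  proof -
    have "1 - exp (s - t) \<le> t - s"
      using exp_ge_add_one_self [of "s - t"] by linarith
    then have "(1 - exp (s - t)) * exp t \<le> (t - s) * exp t"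
      by (intro mult_right_mono) auto
    then show ?thesis
      by (simp add: algebra_simps exp_diff)
  qed
  show ?thesis
    using * [of a b] * [of b a] by (cases "a \<le> b") (auto simp: max_def abs_if)
qed

lemma abs_f_dens_diff_le:
  assumes "\<bar>u\<bar> \<le> m"
  shows "\<bar>f_dens u z - f_dens u z'\<bar> \<le> m * \<bar>z - z'\<bar> * exp (m * (\<bar>z\<bar> + \<bar>z'\<bar>))"
proof -
  have m: "m \<ge> 0"
    using assms by linarith
  \<comment> \<open>The factor depending on \<open>u\<close> alone is at most 1, which leaves a
    difference of two exponentials.\<close>
  have eq: "f_dens u z = exp (- u\<^sup>2 / 2) * exp (z * u)" for z
    by (simp add: f_dens_def exp_add [symmetric] field_simps)
  have "\<bar>f_dens u z - f_dens u z'\<bar> = exp (- u\<^sup>2 / 2) * \<bar>exp (z * u) - exp (z' * u)\<bar>"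
    by (simp add: eq abs_mult right_diff_distrib [symmetric])
  also have "\<dots> \<le> 1 * \<bar>exp (z * u) - exp (z' * u)\<bar>"
    by (intro mult_right_mono) auto
  also have "\<dots> \<le> \<bar>z * u - z' * u\<bar> * exp (max (z * u) (z' * u))"
    using abs_exp_diff_le by simp
  also have "\<bar>z * u - z' * u\<bar> = \<bar>u\<bar> * \<bar>z - z'\<bar>"
    by (metis abs_mult left_diff_distrib mult.commute)
  also have "\<bar>u\<bar> * \<bar>z - z'\<bar> * exp (max (z * u) (z' * u))
      \<le> m * \<bar>z - z'\<bar> * exp (m * (\<bar>z\<bar> + \<bar>z'\<bar>))"
  proof (intro mult_mono)
    have "m * \<bar>z\<bar> \<ge> 0" "m * \<bar>z'\<bar> \<ge> 0"
      using m by simp_all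
    then show "exp (max (z * u) (z' * u)) \<le> exp (m * (\<bar>z\<bar> + \<bar>z'\<bar>))"
      using mult_le_abs_bound [OF assms, of z] mult_le_abs_bound [OF assms, of z'] by (simp add: distrib_left)
  qed (use assms m in auto)
  finally show ?thesis .
qed

text \<open>With \<open>A\<close>, \<open>A'\<close> the stage costs and \<open>f\<close>,
  \<open>f'\<close> the densities at the exact and quantized observations,
  \<open>A f - A' f' = (A - A') f + A' (f - f')\<close>. The slack 1 in \<open>dom_const\<close> is
  what bounds \<open>A'\<close>.\<close>

lemma c_red_le_quant_err:
  assumes lam: "lam > 0" and u: "\<bar>u\<bar> \<le> m" and w: "\<bar>w\<bar> \<le> m" and y: "\<bar>y'\<bar> \<le> \<bar>y\<bar> + 1"
  shows "c_red lam y z u w \<le> c_red lam y' z' u w + quant_err lam m y y' z z'"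
proof -
  let ?A = "lam * (u - y)\<^sup>2 + (w - u)\<^sup>2" and ?A' = "lam * (u - y')\<^sup>2 + (w - u)\<^sup>2"
  have m: "m \<ge> 0"
    using u by linarith
  have "(u - y)\<^sup>2 - (u - y')\<^sup>2 = (y' - y) * (2 * u - y - y')"
    by (simp add: power2_eq_square algebra_simps)
  also have "\<dots> \<le> \<bar>y' - y\<bar> * \<bar>2 * u - y - y'\<bar>"
    by (metis abs_ge_self abs_mult)
  also have "\<dots> \<le> \<bar>y - y'\<bar> * (2 * m + \<bar>y\<bar> + \<bar>y'\<bar>)"
    using u by (intro mult_mono) auto
  finally have "lam * ((u - y)\<^sup>2 - (u - y')\<^sup>2) \<le> lam * (\<bar>y - y'\<bar> * (2 * m + \<bar>y\<bar> + \<bar>y'\<bar>))"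
    using lam by (intro mult_left_mono) auto
  then have A: "?A - ?A' \<le> lam * (\<bar>y - y'\<bar> * (2 * m + \<bar>y\<bar> + \<bar>y'\<bar>))"
    by (simp add: algebra_simps)
  have 1: "(?A - ?A') * f_dens u z \<le> lam * (\<bar>y - y'\<bar> * (2 * m + \<bar>y\<bar> + \<bar>y'\<bar>)) * exp (m * \<bar>z\<bar>)"
    using A f_dens_le_exp [OF u] f_dens_pos [THEN less_imp_le] lam m
    by (intro mult_mono) auto
  have "?A' * (f_dens u z - f_dens u z') \<le> ?A' * \<bar>f_dens u z - f_dens u z'\<bar>"
    using lam by (intro mult_left_mono) auto
  also have "\<dots> \<le> dom_const lam m * (1 + y\<^sup>2) * (m * \<bar>z - z'\<bar> * exp (m * (\<bar>z\<bar> + \<bar>z'\<bar>)))"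
    using abs_f_dens_diff_le [OF u] stage_cost_le_dom_const [OF lam u w y] lam
    by (intro mult_mono) (auto simp: dom_const_def)
  finally have 2: "?A' * (f_dens u z - f_dens u z')
    \<le> dom_const lam m * (1 + y\<^sup>2) * (m * \<bar>z - z'\<bar> * exp (m * (\<bar>z\<bar> + \<bar>z'\<bar>)))" .
  have "c_red lam y z u w
      = c_red lam y' z' u w + (?A - ?A') * f_dens u z + ?A' * (f_dens u z - f_dens u z')"
    unfolding c_red_def by algebra
  then show ?thesis
    unfolding quant_err_def using 1 2 by linarith
qed

text \<open>The factor 5 is 4 for the stage-cost difference plus 1 for the density
  difference.\<close>

lemma quant_err_le_dom:
  assumes lam: "lam > 0" and m: "m > 0" and y: "\<bar>y'\<bar> \<le> \<bar>y\<bar> + 1" and z: "\<bar>z'\<bar> \<le> \<bar>z\<bar> + 1"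
  shows "quant_err lam m y y' z z'
    \<le> 5 * dom_const lam m * exp (2 * m) * (1 + y\<^sup>2) * exp (4 * m * \<bar>z\<bar>)"
proof -
  let ?B = "dom_const lam m * (1 + y\<^sup>2)" and ?E = "exp (2 * m * (2 * \<bar>z\<bar> + 1))"
  have mz: "m * \<bar>z\<bar> \<ge> 0"
    using m by simp
  have "\<bar>y - y'\<bar> * (2 * m + \<bar>y\<bar> + \<bar>y'\<bar>) \<le> (2 * (m + 1 + \<bar>y\<bar>)) * (2 * (m + 1 + \<bar>y\<bar>))"
    using y m by (intro mult_mono) auto
  also have "\<dots> = 4 * (m + 1 + \<bar>y\<bar>)\<^sup>2"
    by (simp add: power2_eq_square algebra_simps)
  also have "\<dots> \<le> 4 * (2 * (m + 1)\<^sup>2 + 2 * y\<^sup>2)"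
    using sum_squares_bound [of "m + 1" "\<bar>y\<bar>"] by (simp add: power2_sum)
  finally have "lam * (\<bar>y - y'\<bar> * (2 * m + \<bar>y\<bar> + \<bar>y'\<bar>)) \<le> lam * (4 * (2 * (m + 1)\<^sup>2 + 2 * y\<^sup>2))"
    using lam by (intro mult_left_mono) auto
  also have "\<dots> \<le> 4 * ?B"
  proof -
    have "4 * ?B = lam * (4 * (2 * (m + 1)\<^sup>2 + 2 * y\<^sup>2))
        + (8 * lam + 16 * m\<^sup>2 + 16 * (m\<^sup>2 * y\<^sup>2) + 8 * (lam * (m + 1)\<^sup>2 * y\<^sup>2))"
      by (simp add: dom_const_def algebra_simps)
    moreover have "0 \<le> m\<^sup>2" "0 \<le> m\<^sup>2 * y\<^sup>2" "0 \<le> lam * (m + 1)\<^sup>2 * y\<^sup>2"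
      using lam by simp_all
    ultimately show ?thesis
      using lam by linarith
  qed
  finally have Y: "lam * (\<bar>y - y'\<bar> * (2 * m + \<bar>y\<bar> + \<bar>y'\<bar>)) \<le> 4 * ?B" .
  have B: "?B \<ge> 0"
    using lam by (simp add: dom_const_def)
  have 1: "lam * (\<bar>y - y'\<bar> * (2 * m + \<bar>y\<bar> + \<bar>y'\<bar>)) * exp (m * \<bar>z\<bar>) \<le> 4 * ?B * ?E"
    using B m mz by (intro mult_mono [OF Y]) (auto simp: algebra_simps)
  have le: "m * (\<bar>z\<bar> + \<bar>z'\<bar>) \<le> m * (2 * \<bar>z\<bar> + 1)"
    using z m by (intro mult_left_mono) auto
  \<comment> \<open>The linear factor is absorbed by \<open>x \<le> exp x\<close>, which doubles the
    exponent and accounts for \<open>4 * m * \<bar>z\<bar>\<close> in the final bound.\<close>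
  have "m * \<bar>z - z'\<bar> \<le> m * (2 * \<bar>z\<bar> + 1)"
    using z m by (intro mult_left_mono) auto
  also have "\<dots> \<le> exp (m * (2 * \<bar>z\<bar> + 1))"
    using exp_ge_add_one_self [of "m * (2 * \<bar>z\<bar> + 1)"] by linarith
  finally have "m * \<bar>z - z'\<bar> * exp (m * (\<bar>z\<bar> + \<bar>z'\<bar>))
      \<le> exp (m * (2 * \<bar>z\<bar> + 1)) * exp (m * (2 * \<bar>z\<bar> + 1))"
    using le m by (intro mult_mono) auto
  also have "\<dots> = ?E"
    by (simp add: exp_add [symmetric])
  finally have 2: "?B * (m * \<bar>z - z'\<bar> * exp (m * (\<bar>z\<bar> + \<bar>z'\<bar>))) \<le> ?B * ?E"
    using B by (intro mult_left_mono) auto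
  have "quant_err lam m y y' z z' \<le> 5 * (?B * ?E)"
    unfolding quant_err_def using 1 2 by linarith
  also have "?E = exp (2 * m) * exp (4 * m * \<bar>z\<bar>)"
    by (simp add: exp_add [symmetric] algebra_simps)
  finally show ?thesis
    by (simp add: mult_ac)
qed

lemma borel_measurable_quant_err [measurable (raw)]:
  assumes [measurable]: "a \<in> borel_measurable M" "b \<in> borel_measurable M"
    "c \<in> borel_measurable M" "d \<in> borel_measurable M"
  shows "(\<lambda>x. quant_err lam m (a x) (b x) (c x) (d x)) \<in> borel_measurable M"
  unfolding quant_err_def by measurable

text \<open>For fixed \<open>m\<close> the error vanishes at exact observations and is continuous in
  the quantized ones, and its majorant does not depend on \<open>k\<close>.\<close>

lemma nn_integral_quant_err_tendsto_0:
  assumes lam: "lam > 0" and m: "m > 0"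
  shows "(\<lambda>k. \<integral>\<^sup>+(y, z). ennreal (quant_err lam m y (rate_quantizer k y) z (rate_quantizer k z))
    \<partial>gauss2) \<longlonglongrightarrow> 0"
proof -
  have "(\<lambda>k. \<integral>\<^sup>+(y, z). ennreal (quant_err lam m y (rate_quantizer k y) z (rate_quantizer k z))
      \<partial>gauss2) \<longlonglongrightarrow> (\<integral>\<^sup>+x. 0 \<partial>gauss2)"
  proof (rule nn_integral_dominated_convergence
    [where w = "\<lambda>(y, z). ennreal (5 * dom_const lam m * exp (2 * m) * (1 + y\<^sup>2) * exp (4 * m * \<bar>z\<bar>))"])
    show "(\<integral>\<^sup>+x. (case x of (y, z) \<Rightarrow>
        ennreal (5 * dom_const lam m * exp (2 * m) * (1 + y\<^sup>2) * exp (4 * m * \<bar>z\<bar>))) \<partial>gauss2) < \<infinity>"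
      using lam by (intro nn_integral_gauss2_dominating) (simp add: dom_const_def)
    show "AE x in gauss2. (\<lambda>k. case x of (y, z) \<Rightarrow>
        ennreal (quant_err lam m y (rate_quantizer k y) z (rate_quantizer k z))) \<longlonglongrightarrow> 0"
    proof (intro AE_I2, clarify)
      fix y z
      have "(\<lambda>k. quant_err lam m y (rate_quantizer k y) z (rate_quantizer k z))
          \<longlonglongrightarrow> quant_err lam m y y z z"
        unfolding quant_err_def by (intro tendsto_intros rate_quantizer_tendsto)
      then show "(\<lambda>k. ennreal (quant_err lam m y (rate_quantizer k y) z (rate_quantizer k z))) \<longlonglongrightarrow> 0"
        using tendsto_ennrealI by (fastforce simp: quant_err_def)
    qed
    show "AE x in gauss2. (case x of (y, z) \<Rightarrow>
          ennreal (quant_err lam m y (rate_quantizer j y) z (rate_quantizer j z)))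
        \<le> (case x of (y, z) \<Rightarrow>
          ennreal (5 * dom_const lam m * exp (2 * m) * (1 + y\<^sup>2) * exp (4 * m * \<bar>z\<bar>)))" for j
      using quant_err_le_dom [OF lam m abs_rate_quantizer_le abs_rate_quantizer_le]
      by (auto intro!: AE_I2 ennreal_leI)
  qed measurable
  then show ?thesis
    by simp
qed

text \<open>The error integral is free of \<open>p1\<close> and \<open>p2\<close>, so
  \<open>k\<close> can be fixed before any optimal pair of the finite model is considered.\<close>

lemma W_cost_le_J_fin:
  fixes k :: nat
  assumes lam: "lam > 0" and m: "m > 0"
  defines "l \<equiv> real (Suc k)" and "n \<equiv> (Suc k)\<^sup>2"
  assumes p: "p1 \<in> Pol_fin l n m" "p2 \<in> Pol_fin l n m"
  shows "W_cost lam (p1 \<circ> quantizer l n) (p2 \<circ> quantizer l n) \<le> ennreal (J_fin lam l n p1 p2)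
    + (\<integral>\<^sup>+(y, z). ennreal (quant_err lam m y (rate_quantizer k y) z (rate_quantizer k z)) \<partial>gauss2)"
proof -
  let ?q = "rate_quantizer k"
  have q: "quantizer l n = ?q"
    by (simp add: rate_quantizer_def l_def n_def)
  have ln: "l > 0" "n \<ge> 1"
    by (simp_all add: l_def n_def)
  note Z = finite_Z_fin quantizer_in_Z_fin [OF ln, unfolded q]
  have [measurable]: "(\<lambda>y. p1 (?q y)) \<in> borel_measurable borel"
      "(\<lambda>y. p2 (?q y)) \<in> borel_measurable borel"
    using borel_measurable_compose_finite_range [OF borel_measurable_rate_quantizer Z] by blast+
  have bnd: "\<bar>(p1 \<circ> ?q) y\<bar> \<le> m" "\<bar>(p2 \<circ> ?q) y\<bar> \<le> m" for y
    using p Z(2) [of y] by (auto simp: Pol_fin_def abs_le_iff dest!: PiE_mem)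
  have qe: "quant_err lam m y (?q y) z (?q z) \<ge> 0" for y z
    using lam m by (simp add: quant_err_def dom_const_def)
  have "W_cost lam (p1 \<circ> ?q) (p2 \<circ> ?q)
      = (\<integral>\<^sup>+(y, z). ennreal (c_red lam y z ((p1 \<circ> ?q) y) ((p2 \<circ> ?q) z)) \<partial>gauss2)"
    using lam by (intro W_cost_c_red) (auto simp: comp_def)
  also have "\<dots> \<le> (\<integral>\<^sup>+x. (case x of (y, z) \<Rightarrow>
          ennreal (c_red lam (?q y) (?q z) ((p1 \<circ> ?q) y) ((p2 \<circ> ?q) z)))
        + (case x of (y, z) \<Rightarrow> ennreal (quant_err lam m y (?q y) z (?q z))) \<partial>gauss2)"
    using c_red_le_quant_err [OF lam bnd abs_rate_quantizer_le] qe lam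
    by (intro nn_integral_mono)
      (auto simp: ennreal_plus [symmetric] c_red_nonneg simp del: ennreal_plus)
  also have "\<dots> = ennreal (J_fin lam l n p1 p2)
      + (\<integral>\<^sup>+(y, z). ennreal (quant_err lam m y (?q y) z (?q z)) \<partial>gauss2)"
    by (subst nn_integral_add) (auto simp: J_fin_nn_integral [OF lam ln] q)
  finally show ?thesis
    by (simp add: q)
qed

text \<open>Continuity turns convergence of the quantized observations into convergence of the
  controls. For merely measurable policies this could fail: the levels of all the quantizers form a
  countable, hence null, set, and \<open>J_fin\<close> sees only the values there.\<close>

lemma J_fin_restrict_tendsto:
  assumes g: "continuous_on UNIV g1" "continuous_on UNIV g2"
    and lam: "lam > 0" and m: "\<And>y. \<bar>g1 y\<bar> \<le> m" "\<And>z. \<bar>g2 z\<bar> \<le> m"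
  shows "(\<lambda>k. ennreal (J_fin lam (real (Suc k)) ((Suc k)\<^sup>2) g1 g2)) \<longlonglongrightarrow> W_cost lam g1 g2"
proof -
  have [measurable]: "g1 \<in> borel_measurable borel" "g2 \<in> borel_measurable borel"
    using g by (auto intro: borel_measurable_continuous_onI)
  have lim: "(\<lambda>k. g (rate_quantizer k y)) \<longlonglongrightarrow> g y"
    if "continuous_on UNIV g" for g :: "real \<Rightarrow> real" and y
    using continuous_on_tendsto_compose [OF that rate_quantizer_tendsto] by simp
  have "(\<lambda>k. \<integral>\<^sup>+(y, z). ennreal (c_red lam (rate_quantizer k y) (rate_quantizer k z)
        ((g1 \<circ> rate_quantizer k) y) ((g2 \<circ> rate_quantizer k) z)) \<partial>gauss2)
      \<longlonglongrightarrow> (\<integral>\<^sup>+(y, z). ennreal (c_red lam y z (g1 y) (g2 z)) \<partial>gauss2)"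
    using lam m lim [OF g(1)] lim [OF g(2)]
    by (intro nn_integral_c_red_tendsto [where m = m])
      (auto simp: abs_rate_quantizer_le rate_quantizer_tendsto)
  then show ?thesis
    using lam by (simp add: W_cost_c_red J_fin_nn_integral rate_quantizer_def del: of_nat_Suc)
qed

section \<open>Choice of the finite model and conclusion\<close>

theorem theorem9:
  fixes lam eps :: real
  assumes "lam > 0" and "eps > 0"
  shows "\<exists>(l::real) (n::nat) (m::real). l > 0 \<and> n \<ge> 1 \<and> m > 0 \<and>
    (\<forall>p1 p2. optimal_fin lam l n m p1 p2 \<longrightarrow>
      W_cost lam (p1 \<circ> quantizer l n) (p2 \<circ> quantizer l n) \<le> W_opt lam + ennreal eps)"
proof -
  \<comment> \<open>Half of \<open>eps\<close> pays for replacing the infimum by a bounded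
    continuous pair, the other half for the quantization error.\<close>
  define r where "r = W_opt lam + ennreal (eps / 2)"
  have r: "W_opt lam < r"
    using W_opt_finite [OF assms(1)] assms(2)
    by (simp add: r_def ennreal_add_left_cancel_less [of _ 0, simplified])
  obtain g1 g2 m where g: "continuous_on UNIV g1" "continuous_on UNIV g2" and m: "m > 0"
    and b: "\<And>y. \<bar>g1 y\<bar> \<le> m" "\<And>z. \<bar>g2 z\<bar> \<le> m" and cost: "W_cost lam g1 g2 < r"
    using continuous_policies_near_optimal [OF assms(1) r] by blast
  \<comment> \<open>The bound \<open>m\<close> comes from the continuous pair and is fixed before
    the quantizer, because the error depends on it.\<close>
  let ?D = "\<lambda>k. \<integral>\<^sup>+(y, z). ennreal (quant_err lam m y (rate_quantizer k y) z (rate_quantizer k z))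
    \<partial>gauss2"
  have "\<forall>\<^sub>F k in sequentially. ennreal (J_fin lam (real (Suc k)) ((Suc k)\<^sup>2) g1 g2) < r"
    using J_fin_restrict_tendsto [OF g assms(1) b] cost by (rule order_tendstoD(2))
  moreover have "\<forall>\<^sub>F k in sequentially. ?D k < ennreal (eps / 2)"
    using nn_integral_quant_err_tendsto_0 [OF assms(1) m]
    by (rule order_tendstoD(2)) (use assms(2) in simp)
  ultimately have "\<forall>\<^sub>F k in sequentially.
      ennreal (J_fin lam (real (Suc k)) ((Suc k)\<^sup>2) g1 g2) < r \<and> ?D k < ennreal (eps / 2)"
    by (rule eventually_conj)
  then obtain k where k: "ennreal (J_fin lam (real (Suc k)) ((Suc k)\<^sup>2) g1 g2) < r"
    "?D k < ennreal (eps / 2)"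
    by (auto simp: eventually_sequentially)
  define l n where "l = real (Suc k)" and "n = (Suc k)\<^sup>2"
  show ?thesis
  proof (intro exI conjI allI impI)
    show "l > 0" "n \<ge> 1" "m > 0"
      using m by (simp_all add: l_def n_def)
    fix p1 p2
    assume opt: "optimal_fin lam l n m p1 p2"
    \<comment> \<open>\<open>Pol_fin\<close> consists of extensional functions, so the competitors
      must be restricted to the levels. \<open>J_fin\<close> reads only values on the levels, so
      their cost is that of \<open>g1\<close> and \<open>g2\<close>.\<close>
    let ?g1 = "restrict g1 (Z_fin l n)" and ?g2 = "restrict g2 (Z_fin l n)"
    have "?g1 \<in> Pol_fin l n m" "?g2 \<in> Pol_fin l n m"
      using b by (auto simp: Pol_fin_def abs_le_iff minus_le_iff)
    then have "J_fin lam l n p1 p2 \<le> J_fin lam l n ?g1 ?g2"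
      using opt by (simp add: optimal_fin_def)
    also have "\<dots> = J_fin lam l n g1 g2"
      unfolding J_fin_def by (intro sum.cong) auto
    finally have J: "ennreal (J_fin lam l n p1 p2) \<le> r"
      using k(1) by (metis ennreal_leI l_def n_def order.strict_implies_order order.trans)
    have "W_cost lam (p1 \<circ> quantizer l n) (p2 \<circ> quantizer l n)
        \<le> ennreal (J_fin lam l n p1 p2) + ?D k"
      using opt W_cost_le_J_fin [OF assms(1) m] by (simp add: optimal_fin_def l_def n_def)
    also have "\<dots> \<le> r + ennreal (eps / 2)"
      using J k(2) by (intro add_mono) auto
    also have "\<dots> = W_opt lam + ennreal eps"
      using assms(2) by (simp add: r_def add.assoc ennreal_plus [symmetric] del: ennreal_plus)
    finally show "W_cost lam (p1 \<circ> quantizer l n) (p2 \<circ> quantizer l n) \<le> W_opt lam + ennreal eps" .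
  qed
qed

end
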